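(* Let $\mathscr{D} = \bigl((\ell_j)_{j \in J}, (q_j)_{j \in J}\bigr)$ be a Brascamp-Lieb datum, with linear maps $\ell_j : H \to H_j$. Set $C:=1+\sup_{j\in J} \|\ell_{j}\|$, where $\|\cdot\|$ is the operator norm. Then for all $\alpha \in (0, 1]$ and all linear subspaces $W\subseteq H$, \[ \operatorname{BL}(\mathscr{D}) \geq \Bigl(C^2\sum_{j \in J} q_j \Bigr)^{-\dim H / 2} \alpha^{\sum_{j \in J} q_j \operatorname{rk}_{\alpha}(\ell_j \mid W) - \dim W}. \]
   Context: A Euclidean space is a finite-dimensional real Hilbert space, equipped with the Lebesgue measure induced by its inner product. A Brascamp-Lieb datum $\mathscr{D}=((\ell_j)_{j\in J},(q_j)_{j\in J})$ consists of a finite index set $J$, Euclidean spaces $H$ and $H_j$ ($j\in J$), linear maps $\ell_j:H\to H_j$, and real numbers $q_j>0$. The Brascamp-Lieb constant $\operatorname{BL}(\mathscr{D})\in[0,+\infty]$ is the smallest constant such that \[ \int_{H} \prod_{j \in J} (f_{j}\circ \ell_{j})^{q_{j}} \leq \operatorname{BL}(\mathscr{D}) \prod_{j \in J} \Bigl(\int_{H_{j}} f_{j} \Bigr)^{q_{j}} \] for all collections $(f_j)_{j\in J}$ of measurable functions $f_j:H_j\to\mathbb{R}_{\ge0}$ (it is $+\infty$ if no finite constant works). For a linear map $\ell:H\to H'$ between Euclidean spaces and $\alpha\ge0$, the $\alpha$-essential rank $\operatorname{rk}_\alpha(\ell)$ is the number (counted with multiplicity) of singular values of $\ell$ that are strictly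 greater than $\alpha$. For a subspace $W\subseteq H$, $\operatorname{rk}_\alpha(\ell\mid W):=\operatorname{rk}_\alpha(\ell_{|W})$, where $\ell_{|W}:W\to H'$ is the restriction. *)

theory Defs
  imports "HOL-Analysis.Analysis"
begin

text \<open>
  The spaces of a Brascamp-Lieb datum have dimensions depending on the index, so a Euclidean space is
  represented as a linear subspace of an ambient type of class \<^class>\<open>euclidean_space\<close>, with the
  induced inner product. The zero space is thereby included. The spaces \<open>K j\<close> share one ambient type;
  this loses no generality, because finitely many Euclidean spaces embed isometrically
  into their orthogonal direct sum. A linear map between subspaces is a function on the ambient
  types of which only the values on the domain subspace matter.
\<close>

definition linear_on ::
  "'a::euclidean_space set \<Rightarrow> 'b::euclidean_space set \<Rightarrow> ('a \<Rightarrow> 'b) \<Rightarrow> bool" where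
  "linear_on V V' l \<longleftrightarrow>
     l ` V \<subseteq> V' \<and>
     (\<forall>x\<in>V. \<forall>y\<in>V. l (x + y) = l x + l y) \<and>
     (\<forall>c. \<forall>x\<in>V. l (c *\<^sub>R x) = c *\<^sub>R l x)"

text \<open>As in the library's \<^const>\<open>onorm\<close>, the point \<open>x = 0\<close> contributes \<open>0 / 0 = 0\<close>.\<close>

definition onorm_on ::
  "'a::euclidean_space set \<Rightarrow> ('a \<Rightarrow> 'b::euclidean_space) \<Rightarrow> real" where
  "onorm_on V l = (SUP x\<in>V. norm (l x) / norm x)"

definition is_orthonormal_basis ::
  "'a::euclidean_space set \<Rightarrow> 'a set \<Rightarrow> bool" where
  "is_orthonormal_basis V B \<longleftrightarrow>
     pairwise orthogonal B \<and> (\<forall>b\<in>B. norm b = 1) \<and> span B = V"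

text \<open>
  Lebesgue measure of a subspace \<open>V\<close>, on its Borel sets: the image of the product Lebesgue measure
  under orthonormal coordinates. The choice of the orthonormal basis is immaterial, since orthogonal
  maps preserve Lebesgue measure. On the zero space this is the Dirac measure at \<open>0\<close>.
\<close>

definition subspace_lborel :: "'a::euclidean_space set \<Rightarrow> 'a measure" where
  "subspace_lborel V =
     (let B = (SOME B. is_orthonormal_basis V B) in
       distr (\<Pi>\<^sub>M b\<in>B. (lborel :: real measure)) (restrict_space borel V)
         (\<lambda>c. \<Sum>b\<in>B. c b *\<^sub>R b))"

text \<open>
  Real powers in \<open>[0, \<infinity>]\<close>, with the usual conventions at the end points; in particular
  \<open>0\<close> to a negative power is \<open>\<infinity>\<close>, and the exponent \<open>0\<close> gives \<open>1\<close>.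
\<close>

definition ennreal_powr :: "ennreal \<Rightarrow> real \<Rightarrow> ennreal" where
  "ennreal_powr x p =
     (if p = 0 then 1
      else if x = 0 then (if p > 0 then 0 else top)
      else if x = top then (if p > 0 then top else 0)
      else ennreal (enn2real x powr p))"

locale brascamp_lieb_datum =
  fixes J :: "'j set"
    and H :: "'a::euclidean_space set"
    and K :: "'j \<Rightarrow> 'b::euclidean_space set"
    and l :: "'j \<Rightarrow> 'a \<Rightarrow> 'b"
    and q :: "'j \<Rightarrow> real"
  assumes finite_index: "finite J"
    and subspace_domain: "subspace H"
    and subspace_codomain: "j \<in> J \<Longrightarrow> subspace (K j)"
    and linear_map: "j \<in> J \<Longrightarrow> linear_on H (K j) (l j)"
    and exponent_pos: "j \<in> J \<Longrightarrow> q j > 0"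

text \<open>
  Measurable means Borel measurable, so that the compositions \<open>f j \<circ> l j\<close> are measurable even when
  \<open>l j\<close> is not surjective. Products in \<^typ>\<open>ennreal\<close> use \<open>0 * \<infinity> = 0\<close>.
\<close>

definition is_BL_bound ::
  "'j set \<Rightarrow> 'a::euclidean_space set \<Rightarrow> ('j \<Rightarrow> 'b::euclidean_space set) \<Rightarrow>
   ('j \<Rightarrow> 'a \<Rightarrow> 'b) \<Rightarrow> ('j \<Rightarrow> real) \<Rightarrow> ennreal \<Rightarrow> bool" where
  "is_BL_bound J H K l q c \<longleftrightarrow>
     (\<forall>f :: 'j \<Rightarrow> 'b \<Rightarrow> real.
        (\<forall>j\<in>J. f j \<in> borel_measurable (subspace_lborel (K j)) \<and> (\<forall>y\<in>K j. 0 \<le> f j y)) \<longrightarrow>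
        (\<integral>\<^sup>+ x. ennreal (\<Prod>j\<in>J. f j (l j x) powr q j) \<partial>subspace_lborel H)
          \<le> c * (\<Prod>j\<in>J. ennreal_powr (\<integral>\<^sup>+ y. ennreal (f j y) \<partial>subspace_lborel (K j)) (q j)))"

definition BL ::
  "'j set \<Rightarrow> 'a::euclidean_space set \<Rightarrow> ('j \<Rightarrow> 'b::euclidean_space set) \<Rightarrow>
   ('j \<Rightarrow> 'a \<Rightarrow> 'b) \<Rightarrow> ('j \<Rightarrow> real) \<Rightarrow> ennreal" where
  "BL J H K l q = Inf {c. c < top \<and> is_BL_bound J H K l q c}"

text \<open>
  The adjoint of the restriction of \<open>l\<close> to \<open>W\<close>, with values in \<open>W\<close>. The singular values of that
  restriction are the square roots of the eigenvalues of \<open>adjoint_on W l \<circ> l\<close> on \<open>W\<close>, and their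
  multiplicities are the dimensions of the eigenspaces.
\<close>

definition adjoint_on ::
  "'a::euclidean_space set \<Rightarrow> ('a \<Rightarrow> 'b::euclidean_space) \<Rightarrow> 'b \<Rightarrow> 'a" where
  "adjoint_on W l y = (THE z. z \<in> W \<and> (\<forall>x\<in>W. l x \<bullet> y = x \<bullet> z))"

definition singular_space ::
  "'a::euclidean_space set \<Rightarrow> ('a \<Rightarrow> 'b::euclidean_space) \<Rightarrow> real \<Rightarrow> 'a set" where
  "singular_space W l s = {x \<in> W. adjoint_on W l (l x) = s\<^sup>2 *\<^sub>R x}"

definition singular_values ::
  "'a::euclidean_space set \<Rightarrow> ('a \<Rightarrow> 'b::euclidean_space) \<Rightarrow> real set" where
  "singular_values W l = {s. 0 \<le> s \<and> (\<exists>x \<in> singular_space W l s. x \<noteq> 0)}"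

definition ess_rank ::
  "real \<Rightarrow> ('a::euclidean_space \<Rightarrow> 'b::euclidean_space) \<Rightarrow> 'a set \<Rightarrow> nat" where
  "ess_rank \<alpha> l W = (\<Sum>s \<in> {s \<in> singular_values W l. \<alpha> < s}. dim (singular_space W l s))"

end

theory Submission
  imports Defs "HOL-Probability.Distributions"
begin

text \<open>
  Test the inequality on Gaussians. For each \<open>j\<close> split \<open>K j\<close> into the span of the images of the singular
  vectors of \<open>l j\<close> on \<open>W\<close> with singular value above \<open>\<alpha>\<close> and its complement, and let \<open>f j\<close> have width
  \<open>1 / \<alpha>\<close> along the former and 1 along the latter, so that its integral is \<open>\<alpha>\<close> to the power minus the
  essential rank. On \<open>H\<close>, the quadratic form in the exponent of \<open>f j \<circ> l j\<close> is at most \<open>C\<^sup>2\<close> times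
  the one with weight \<open>\<alpha>\<^sup>2\<close> on \<open>W\<close> and 1 on its orthogonal complement, so the left-hand side is at least an
  explicit Gaussian integral.
\<close>

section \<open>Orthonormal bases of subspaces\<close>

lemma is_orthonormal_basis_finite: "is_orthonormal_basis V B \<Longrightarrow> finite B"
  by (auto simp: is_orthonormal_basis_def intro: pairwise_orthogonal_imp_finite)

lemma is_orthonormal_basis_subset: "is_orthonormal_basis V B \<Longrightarrow> B \<subseteq> V"
  by (auto simp: is_orthonormal_basis_def intro: span_base)

lemma is_orthonormal_basis_subspace: "is_orthonormal_basis V B \<Longrightarrow> subspace V"
  by (auto simp: is_orthonormal_basis_def intro: subspace_span)

lemma is_orthonormal_basis_inner:
  assumes "is_orthonormal_basis V B" "b \<in> B" "b' \<in> B"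
  shows "b \<bullet> b' = (if b = b' then 1 else 0)"
  using assms
  by (auto simp: is_orthonormal_basis_def pairwise_def orthogonal_def norm_eq_1)

lemma is_orthonormal_basis_card:
  assumes "is_orthonormal_basis V B" shows "card B = dim V"
proof -
  have "independent B"
    using assms by (intro pairwise_orthogonal_independent) (auto simp: is_orthonormal_basis_def)
  then show ?thesis
    using assms unfolding is_orthonormal_basis_def by (metis dim_span_eq_card_independent)
qed

lemma is_orthonormal_basis_span:
  assumes "is_orthonormal_basis V B" "F \<subseteq> B"
  shows "is_orthonormal_basis (span F) F"
  using assms by (auto simp: is_orthonormal_basis_def intro: pairwise_mono)

lemma is_orthonormal_basis_expand:
  assumes "is_orthonormal_basis V B" "x \<in> V"
  shows "(\<Sum>b\<in>B. (x \<bullet> b) *\<^sub>R b) = x"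
  using assms is_orthonormal_basis_finite[OF assms(1)]
  by (intro orthonormal_basis_expand) (auto simp: is_orthonormal_basis_def)

lemma is_orthonormal_basis_sum_inner:
  assumes "is_orthonormal_basis V B" "b \<in> B"
  shows "(\<Sum>b\<in>B. c b *\<^sub>R b) \<bullet> b = c b"
proof -
  have "(\<Sum>b'\<in>B. c b' *\<^sub>R b') \<bullet> b = (\<Sum>b'\<in>B. if b' = b then c b' else 0)"
    unfolding inner_sum_left using assms is_orthonormal_basis_inner[OF assms(1) _ assms(2)]
    by (intro sum.cong) auto
  then show ?thesis
    using assms is_orthonormal_basis_finite[OF assms(1)] by simp
qed

lemma is_orthonormal_basis_norm_sum:
  assumes "is_orthonormal_basis V B"
  shows "(norm (\<Sum>b\<in>B. c b *\<^sub>R b))\<^sup>2 = (\<Sum>b\<in>B. (c b)\<^sup>2)"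
  unfolding power2_norm_eq_inner inner_sum_right
  by (intro sum.cong) (auto simp: is_orthonormal_basis_sum_inner[OF assms] power2_eq_square)

lemma is_orthonormal_basis_sum_mem:
  assumes "is_orthonormal_basis V B"
  shows "(\<Sum>b\<in>B. c b *\<^sub>R b) \<in> V"
  using is_orthonormal_basis_subset[OF assms] is_orthonormal_basis_subspace[OF assms]
  by (auto intro!: subspace_sum subspace_scale)

lemma is_orthonormal_basis_norm:
  assumes "is_orthonormal_basis V B" "x \<in> V"
  shows "(norm x)\<^sup>2 = (\<Sum>b\<in>B. (x \<bullet> b)\<^sup>2)"
  using is_orthonormal_basis_norm_sum[OF assms(1), of "\<lambda>b. x \<bullet> b"]
  by (simp add: is_orthonormal_basis_expand[OF assms])

lemma is_orthonormal_basis_exists: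
  assumes "subspace V" shows "\<exists>B. is_orthonormal_basis V B"
  by (rule orthonormal_basis_subspace[OF assms]) (auto simp: is_orthonormal_basis_def)

text \<open>Subtracting from a vector of \<open>V\<close> its projection \<open>p\<close> onto
  \<open>U\<close> leaves a vector of the complement of \<open>U\<close> in \<open>V\<close>, so the
  two bases together span. Disjointness holds because a common element would be a unit vector
  orthogonal to itself; it lets sums over the union be split.\<close>

lemma is_orthonormal_basis_Un:
  assumes F: "is_orthonormal_basis U F" and V: "subspace V" "U \<subseteq> V"
    and G: "is_orthonormal_basis {x \<in> V. \<forall>u\<in>U. x \<bullet> u = 0} G"
  shows "is_orthonormal_basis V (F \<union> G)" "F \<inter> G = {}"
proof -
  have FU: "F \<subseteq> U" and GV: "G \<subseteq> {x \<in> V. \<forall>u\<in>U. x \<bullet> u = 0}"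
    using F G by (auto dest: is_orthonormal_basis_subset)
  have orth: "f \<bullet> g = 0" "g \<bullet> f = 0" if "f \<in> F" "g \<in> G" for f g
  proof -
    have "f \<in> U" "g \<in> {x \<in> V. \<forall>u\<in>U. x \<bullet> u = 0}" using that FU GV by blast+
    then show "g \<bullet> f = 0" by simp
    then show "f \<bullet> g = 0" by (simp add: inner_commute)
  qed
  show "F \<inter> G = {}"
  proof (rule ccontr)
    assume "F \<inter> G \<noteq> {}"
    then obtain f where "f \<in> F" "f \<in> G" by auto
    then show False
      using orth(1)[of f f] is_orthonormal_basis_inner[OF F, of f f] by simp
  qed
  have "span (F \<union> G) = V"
  proof
    show "span (F \<union> G) \<subseteq> V"
      using FU GV V by (intro span_minimal) auto
    show "V \<subseteq> span (F \<union> G)"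
    proof
      fix x assume x: "x \<in> V"
      define p where "p = (\<Sum>f\<in>F. (x \<bullet> f) *\<^sub>R f)"
      have pU: "p \<in> U" unfolding p_def by (rule is_orthonormal_basis_sum_mem[OF F])
      have "(x - p) \<bullet> u = 0" if "u \<in> U" for u
      proof -
        have "(x - p) \<bullet> (\<Sum>f\<in>F. (u \<bullet> f) *\<^sub>R f) = 0"
          unfolding inner_sum_right inner_diff_left
          by (intro sum.neutral) (auto simp: p_def is_orthonormal_basis_sum_inner[OF F])
        then show ?thesis by (simp add: is_orthonormal_basis_expand[OF F that])
      qed
      moreover have "x - p \<in> V"
        using x pU V by (auto intro: subspace_diff)
      ultimately have "x - p \<in> span G"
        using G by (auto simp: is_orthonormal_basis_def)
      moreover have "p \<in> span F" using pU F by (simp add: is_orthonormal_basis_def)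
      ultimately have "(x - p) + p \<in> span (F \<union> G)"
        by (intro span_add) (auto intro: subsetD[OF span_mono])
      then show "x \<in> span (F \<union> G)" by simp
    qed
  qed
  moreover have "pairwise orthogonal (F \<union> G)"
    using F G orth by (auto simp: is_orthonormal_basis_def pairwise_def orthogonal_def)
  ultimately show "is_orthonormal_basis V (F \<union> G)"
    using F G by (auto simp: is_orthonormal_basis_def)
qed

lemma is_orthonormal_basis_extend:
  assumes "is_orthonormal_basis U F" "subspace V" "U \<subseteq> V"
  obtains B where "is_orthonormal_basis V B" "F \<subseteq> B"
proof -
  have "subspace {x \<in> V. \<forall>u\<in>U. x \<bullet> u = 0}"
    using assms(2) by (auto simp: subspace_def inner_add_left)
  then obtain G where "is_orthonormal_basis {x \<in> V. \<forall>u\<in>U. x \<bullet> u = 0} G"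
    using is_orthonormal_basis_exists by blast
  from that[OF is_orthonormal_basis_Un(1)[OF assms this]] show ?thesis by auto
qed

section \<open>Gaussian integrals on a subspace\<close>

interpretation lborel_product: product_sigma_finite "\<lambda>b::'a. lborel :: real measure"
  by standard

text \<open>A product measure is determined by its values on boxes, and the preimage of a box under
  a translation is again a box, with each side translated. This leaves translation invariance of
  \<open>lborel\<close> on the line.\<close>

lemma distr_PiM_lborel_shift:
  assumes "finite B"
  shows "distr (\<Pi>\<^sub>M b\<in>B. (lborel :: real measure)) (\<Pi>\<^sub>M b\<in>B. lborel) (\<lambda>c. \<lambda>b\<in>B. c b + a b)
    = (\<Pi>\<^sub>M b\<in>B. lborel)" (is "distr ?P ?P ?s = _")
proof (rule lborel_product.PiM_eqI[OF assms])
  show "sets (distr ?P ?P ?s) = sets ?P" by simp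
  fix A :: "_ \<Rightarrow> real set" assume A: "\<And>i. i \<in> B \<Longrightarrow> A i \<in> sets lborel"
  have meas: "?s \<in> measurable ?P ?P" by measurable
  have pre: "(\<lambda>x. x + a i) -` A i \<in> sets borel" if "i \<in> B" for i
  proof -
    have "(\<lambda>x. x + a i) \<in> borel_measurable borel" by measurable
    from measurable_sets[OF this, of "A i"] A[OF that] show ?thesis by simp
  qed
  have shift: "emeasure lborel ((\<lambda>x. x + a i) -` A i) = emeasure lborel (A i)" if "i \<in> B" for i
  proof -
    have "emeasure lborel (A i) = emeasure (distr lborel borel ((+) (a i))) (A i)"
      by (simp only: lborel_distr_plus)
    also have "(+) (a i) = (\<lambda>x. x + a i)" by (simp add: fun_eq_iff)
    also have "emeasure (distr lborel borel (\<lambda>x. x + a i)) (A i) = emeasure lborel ((\<lambda>x. x + a i) -` A i)"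
      using A[OF that] by (subst emeasure_distr) auto
    finally show ?thesis by simp
  qed
  have "?s -` (Pi\<^sub>E B A) \<inter> space ?P = (\<Pi>\<^sub>E i\<in>B. (\<lambda>x. x + a i) -` A i)"
  proof (rule set_eqI)
    fix c
    have "c \<in> ?s -` (Pi\<^sub>E B A) \<inter> space ?P \<longleftrightarrow> (\<forall>i\<in>B. c i + a i \<in> A i) \<and> c \<in> extensional B"
      by (simp add: space_PiM PiE_iff)
    then show "c \<in> ?s -` (Pi\<^sub>E B A) \<inter> space ?P \<longleftrightarrow> c \<in> (\<Pi>\<^sub>E i\<in>B. (\<lambda>x. x + a i) -` A i)"
      by (simp add: PiE_iff)
  qed
  moreover have "Pi\<^sub>E B A \<in> sets ?P"
    using A assms by (intro sets_PiM_I_finite) auto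
  ultimately have "emeasure (distr ?P ?P ?s) (Pi\<^sub>E B A) = emeasure ?P (\<Pi>\<^sub>E i\<in>B. (\<lambda>x. x + a i) -` A i)"
    by (simp add: emeasure_distr[OF meas])
  also have "\<dots> = (\<Prod>i\<in>B. emeasure lborel ((\<lambda>x. x + a i) -` A i))"
    using assms pre by (intro lborel_product.emeasure_PiM) auto
  finally show "emeasure (distr ?P ?P ?s) (Pi\<^sub>E B A) = (\<Prod>i\<in>B. emeasure lborel (A i))"
    using shift by simp
qed

lemma nn_integral_lincomb_shift:
  fixes f :: "'a::euclidean_space \<Rightarrow> ennreal"
  assumes B: "is_orthonormal_basis V B" and [measurable]: "f \<in> borel_measurable borel" and a: "a \<in> V"
  shows "(\<integral>\<^sup>+ c. f ((\<Sum>b\<in>B. c b *\<^sub>R b) + a) \<partial>(\<Pi>\<^sub>M b\<in>B. (lborel :: real measure)))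
    = (\<integral>\<^sup>+ c. f (\<Sum>b\<in>B. c b *\<^sub>R b) \<partial>(\<Pi>\<^sub>M b\<in>B. lborel))"
proof -
  let ?P = "\<Pi>\<^sub>M b\<in>B. (lborel :: real measure)"
  let ?s = "\<lambda>c. \<lambda>b\<in>B. c b + a \<bullet> b"
  have "(\<integral>\<^sup>+ c. f (\<Sum>b\<in>B. c b *\<^sub>R b) \<partial>?P) = (\<integral>\<^sup>+ c. f (\<Sum>b\<in>B. c b *\<^sub>R b) \<partial>distr ?P ?P ?s)"
    by (simp only: distr_PiM_lborel_shift[OF is_orthonormal_basis_finite[OF B]])
  also have "\<dots> = (\<integral>\<^sup>+ c. f (\<Sum>b\<in>B. ?s c b *\<^sub>R b) \<partial>?P)"
    by (intro nn_integral_distr) measurable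
  also have "\<dots> = (\<integral>\<^sup>+ c. f ((\<Sum>b\<in>B. c b *\<^sub>R b) + a) \<partial>?P)"
  proof (intro nn_integral_cong arg_cong[where f=f])
    fix c
    have "(\<Sum>b\<in>B. ?s c b *\<^sub>R b) = (\<Sum>b\<in>B. c b *\<^sub>R b) + (\<Sum>b\<in>B. (a \<bullet> b) *\<^sub>R b)"
      by (simp add: scaleR_add_left sum.distrib)
    then show "(\<Sum>b\<in>B. ?s c b *\<^sub>R b) = (\<Sum>b\<in>B. c b *\<^sub>R b) + a"
      by (simp add: is_orthonormal_basis_expand[OF B a])
  qed
  finally show ?thesis by simp
qed

text \<open>Up to the factor \<open>t\<close>, the integrand is the normal density with standard
  deviation \<open>1 / (t * sqrt (2 * pi))\<close>. With \<open>pi\<close> in the exponent, no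
  normalizing constants appear in the later integrals.\<close>

lemma nn_integral_exp_square:
  assumes "0 < t"
  shows "(\<integral>\<^sup>+ x. ennreal (exp (- pi * (t * x)\<^sup>2)) \<partial>lborel) = ennreal (1 / t)"
proof -
  define \<sigma> where "\<sigma> = 1 / (t * sqrt (2 * pi))"
  have \<sigma>: "\<sigma> > 0" using assms by (simp add: \<sigma>_def)
  have \<sigma>2: "2 * pi * \<sigma>\<^sup>2 = 1 / t\<^sup>2"
    by (simp add: \<sigma>_def power_divide power_mult_distrib)
  have \<sigma>2': "2 * \<sigma>\<^sup>2 = 1 / (pi * t\<^sup>2)"
    using assms by (simp add: \<sigma>_def power_divide power_mult_distrib)
  have dens: "normal_density 0 \<sigma> x = t * exp (- pi * (t * x)\<^sup>2)" for x
    unfolding normal_density_def \<sigma>2 \<sigma>2' using assms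
    by (simp add: real_sqrt_divide power_mult_distrib)
  interpret prob_space "density lborel (normal_density 0 \<sigma>)"
    by (rule prob_space_normal_density[OF \<sigma>])
  have "1 = (\<integral>\<^sup>+ x. ennreal (normal_density 0 \<sigma> x) \<partial>lborel)"
    using emeasure_space_1 by (simp add: emeasure_density)
  also have "\<dots> = ennreal t * (\<integral>\<^sup>+ x. ennreal (exp (- pi * (t * x)\<^sup>2)) \<partial>lborel)"
    unfolding dens using assms
    by (subst nn_integral_cmult[symmetric]) (auto simp: ennreal_mult)
  finally have eq: "ennreal t * (\<integral>\<^sup>+ x. ennreal (exp (- pi * (t * x)\<^sup>2)) \<partial>lborel) = 1" by simp
  have "(\<integral>\<^sup>+ x. ennreal (exp (- pi * (t * x)\<^sup>2)) \<partial>lborel)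
     = ennreal (1 / t) * (ennreal t * (\<integral>\<^sup>+ x. ennreal (exp (- pi * (t * x)\<^sup>2)) \<partial>lborel))"
    using assms by (simp add: mult.assoc[symmetric] ennreal_mult[symmetric])
  then show ?thesis unfolding eq by simp
qed

lemma nn_integral_PiM_gaussian:
  assumes B: "is_orthonormal_basis V B" and t: "\<And>b. b \<in> B \<Longrightarrow> 0 < t b"
  shows "(\<integral>\<^sup>+ c. ennreal (exp (- pi * (norm (\<Sum>b\<in>B. (t b * c b) *\<^sub>R b))\<^sup>2))
      \<partial>(\<Pi>\<^sub>M b\<in>B. (lborel :: real measure))) = ennreal (\<Prod>b\<in>B. 1 / t b)"
proof -
  have fin: "finite B" by (rule is_orthonormal_basis_finite[OF B])
  have "(\<integral>\<^sup>+ c. ennreal (exp (- pi * (norm (\<Sum>b\<in>B. (t b * c b) *\<^sub>R b))\<^sup>2)) \<partial>(\<Pi>\<^sub>M b\<in>B. lborel))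
      = (\<integral>\<^sup>+ c. (\<Prod>b\<in>B. ennreal (exp (- pi * (t b * c b)\<^sup>2))) \<partial>(\<Pi>\<^sub>M b\<in>B. lborel))"
    by (simp add: is_orthonormal_basis_norm_sum[OF B] sum_distrib_left sum_negf[symmetric]
        exp_sum[OF fin] prod_ennreal)
  also have "\<dots> = (\<Prod>b\<in>B. (\<integral>\<^sup>+ x. ennreal (exp (- pi * (t b * x)\<^sup>2)) \<partial>lborel))"
    using fin by (intro lborel_product.product_nn_integral_prod) measurable
  also have "\<dots> = (\<Prod>b\<in>B. ennreal (1 / t b))"
    using t by (intro prod.cong nn_integral_exp_square) auto
  also have "\<dots> = ennreal (\<Prod>b\<in>B. 1 / t b)"
    using t by (intro prod_ennreal) (simp add: less_imp_le)
  finally show ?thesis .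
qed

text \<open>
  Uniqueness of Haar measure: both integrals are translation invariant, so Fubini applied to
  \<open>f (x + y) * g y\<close> with an even function \<open>g\<close> gives
  \<open>(\<integral>f d\<mu>) * (\<integral>g d\<nu>) = (\<integral>g d\<mu>) * (\<integral>f d\<nu>)\<close>. A Gaussian \<open>g\<close> has both integrals equal to 1.
\<close>

lemma nn_integral_lincomb_basis_independent:
  fixes f :: "'a::euclidean_space \<Rightarrow> ennreal"
  assumes A: "is_orthonormal_basis V A" and B: "is_orthonormal_basis V B"
    and [measurable]: "f \<in> borel_measurable borel"
  shows "(\<integral>\<^sup>+ c. f (\<Sum>b\<in>A. c b *\<^sub>R b) \<partial>(\<Pi>\<^sub>M b\<in>A. (lborel :: real measure)))
    = (\<integral>\<^sup>+ c. f (\<Sum>b\<in>B. c b *\<^sub>R b) \<partial>(\<Pi>\<^sub>M b\<in>B. lborel))"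
proof -
  let ?P = "\<Pi>\<^sub>M b\<in>A. (lborel :: real measure)" and ?Q = "\<Pi>\<^sub>M b\<in>B. (lborel :: real measure)"
  let ?a = "\<lambda>c. \<Sum>b\<in>A. c b *\<^sub>R b" and ?b = "\<lambda>c. \<Sum>b\<in>B. c b *\<^sub>R b"
  interpret A: finite_product_sigma_finite "\<lambda>b::'a. lborel :: real measure" A
    by standard (rule is_orthonormal_basis_finite[OF A])
  interpret B: finite_product_sigma_finite "\<lambda>b::'a. lborel :: real measure" B
    by standard (rule is_orthonormal_basis_finite[OF B])
  interpret pair_sigma_finite ?P ?Q ..
  define g :: "'a \<Rightarrow> ennreal" where "g x = ennreal (exp (- pi * (norm x)\<^sup>2))" for x
  have [measurable]: "g \<in> borel_measurable borel" unfolding g_def by measurable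
  have gA: "(\<integral>\<^sup>+ c. g (?a c) \<partial>?P) = 1"
    using nn_integral_PiM_gaussian[OF A, of "\<lambda>_. 1"] by (simp add: g_def)
  have gB: "(\<integral>\<^sup>+ c. g (?b c) \<partial>?Q) = 1"
    using nn_integral_PiM_gaussian[OF B, of "\<lambda>_. 1"] by (simp add: g_def)
  have aV: "?a c \<in> V" and bV: "?b c \<in> V" for c
    using A B by (auto intro: is_orthonormal_basis_sum_mem)
  have "(\<integral>\<^sup>+ x. f (?a x) \<partial>?P) = (\<integral>\<^sup>+ y. (\<integral>\<^sup>+ x. f (?a x) \<partial>?P) * g (?b y) \<partial>?Q)"
    by (subst nn_integral_cmult) (simp_all add: gB)
  also have "\<dots> = (\<integral>\<^sup>+ y. (\<integral>\<^sup>+ x. f (?a x + ?b y) * g (?b y) \<partial>?P) \<partial>?Q)"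
    by (intro nn_integral_cong)
       (simp add: nn_integral_multc nn_integral_lincomb_shift[OF A _ bV])
  also have "\<dots> = (\<integral>\<^sup>+ x. (\<integral>\<^sup>+ y. f (?a x + ?b y) * g (?b y) \<partial>?Q) \<partial>?P)"
    by (rule Fubini') measurable
  also have "\<dots> = (\<integral>\<^sup>+ x. (\<integral>\<^sup>+ y. f (?b y) * g (?a x + - ?b y) \<partial>?Q) \<partial>?P)"
  proof (rule nn_integral_cong)
    fix x
    \<comment> \<open>Evenness of \<open>g\<close> enters here: \<open>g\<close> depends only on the
      norm, so \<open>g (?b y)\<close> is also the value of \<open>g\<close> at
      \<open>?a x - (?b y + ?a x)\<close>. The integrand thus becomes a function of the shifted
      point alone.\<close>
    have "(\<integral>\<^sup>+ y. f (?a x + ?b y) * g (?b y) \<partial>?Q)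
        = (\<integral>\<^sup>+ y. (\<lambda>v. f v * g (?a x + - v)) (?b y + ?a x) \<partial>?Q)"
      by (intro nn_integral_cong) (simp add: g_def add.commute)
    also have "\<dots> = (\<integral>\<^sup>+ y. f (?b y) * g (?a x + - ?b y) \<partial>?Q)"
      by (rule nn_integral_lincomb_shift[OF B _ aV]) measurable
    finally show "(\<integral>\<^sup>+ y. f (?a x + ?b y) * g (?b y) \<partial>?Q)
        = (\<integral>\<^sup>+ y. f (?b y) * g (?a x + - ?b y) \<partial>?Q)" .
  qed
  also have "\<dots> = (\<integral>\<^sup>+ y. (\<integral>\<^sup>+ x. f (?b y) * g (?a x + - ?b y) \<partial>?P) \<partial>?Q)"
    by (rule Fubini'[symmetric]) measurable
  also have "\<dots> = (\<integral>\<^sup>+ y. f (?b y) * (\<integral>\<^sup>+ x. g (?a x) \<partial>?P) \<partial>?Q)"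
  proof (rule nn_integral_cong)
    fix y
    have "- ?b y \<in> V"
      using bV is_orthonormal_basis_subspace[OF B] by (rule subspace_neg[rotated])
    from nn_integral_lincomb_shift[OF A _ this, of g]
    show "(\<integral>\<^sup>+ x. f (?b y) * g (?a x + - ?b y) \<partial>?P) = f (?b y) * (\<integral>\<^sup>+ x. g (?a x) \<partial>?P)"
      by (subst nn_integral_cmult) simp_all
  qed
  finally show ?thesis by (simp add: gA)
qed

text \<open>The definition of the measure fixes an arbitrary basis by choice. Independence of the
  basis allows each Gaussian to be integrated in coordinates that diagonalize it.\<close>

lemma nn_integral_subspace_lborel:
  fixes f :: "'a::euclidean_space \<Rightarrow> ennreal"
  assumes B: "is_orthonormal_basis V B" and [measurable]: "f \<in> borel_measurable borel"
  shows "(\<integral>\<^sup>+ x. f x \<partial>subspace_lborel V)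
    = (\<integral>\<^sup>+ c. f (\<Sum>b\<in>B. c b *\<^sub>R b) \<partial>(\<Pi>\<^sub>M b\<in>B. (lborel :: real measure)))"
proof -
  define A where "A = (SOME B. is_orthonormal_basis V B)"
  have A: "is_orthonormal_basis V A" unfolding A_def using B by (rule someI)
  have "(\<lambda>c. \<Sum>b\<in>A. c b *\<^sub>R b) \<in> measurable (\<Pi>\<^sub>M b\<in>A. lborel) (restrict_space borel V)"
    by (rule measurable_restrict_space2) (auto intro: is_orthonormal_basis_sum_mem[OF A])
  then have "(\<integral>\<^sup>+ x. f x \<partial>subspace_lborel V)
      = (\<integral>\<^sup>+ c. f (\<Sum>b\<in>A. c b *\<^sub>R b) \<partial>(\<Pi>\<^sub>M b\<in>A. (lborel :: real measure)))"
    unfolding subspace_lborel_def Let_def A_def[symmetric]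
    by (rule nn_integral_distr) (simp add: measurable_restrict_space1)
  then show ?thesis
    by (simp add: nn_integral_lincomb_basis_independent[OF A B])
qed

lemma nn_integral_subspace_gaussian:
  assumes B: "is_orthonormal_basis V B" and t: "\<And>b. b \<in> B \<Longrightarrow> 0 < t b"
  shows "(\<integral>\<^sup>+ x. ennreal (exp (- pi * (norm (\<Sum>b\<in>B. (t b * (x \<bullet> b)) *\<^sub>R b))\<^sup>2)) \<partial>subspace_lborel V)
    = ennreal (\<Prod>b\<in>B. 1 / t b)"
proof -
  have "(\<integral>\<^sup>+ x. ennreal (exp (- pi * (norm (\<Sum>b\<in>B. (t b * (x \<bullet> b)) *\<^sub>R b))\<^sup>2)) \<partial>subspace_lborel V)
     = (\<integral>\<^sup>+ c. ennreal (exp (- pi * (norm (\<Sum>b\<in>B. (t b * c b) *\<^sub>R b))\<^sup>2))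
      \<partial>(\<Pi>\<^sub>M b\<in>B. (lborel :: real measure)))"
    by (subst nn_integral_subspace_lborel[OF B])
       (auto simp: is_orthonormal_basis_sum_inner[OF B] cong: sum.cong)
  then show ?thesis using nn_integral_PiM_gaussian[OF B t] by simp
qed

lemma space_subspace_lborel [simp]: "space (subspace_lborel V) = V"
  by (simp add: subspace_lborel_def Let_def space_restrict_space)

lemma sets_subspace_lborel [simp, measurable_cong]:
  "sets (subspace_lborel V) = sets (restrict_space borel V)"
  by (simp add: subspace_lborel_def Let_def)

section \<open>Singular values\<close>

text \<open>The extension is \<open>l\<close> composed with the orthogonal projection
  \<open>p\<close> onto \<open>V\<close>. It makes results on linear maps of the whole type
  available for the maps of a datum.\<close>

lemma linear_on_extend:
  assumes l: "linear_on V V' l" and V: "subspace V"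
  obtains l' where "linear l'" "\<And>x. x \<in> V \<Longrightarrow> l' x = l x"
proof -
  obtain B where B: "is_orthonormal_basis V B"
    using is_orthonormal_basis_exists[OF V] by blast
  define p where "p x = (\<Sum>b\<in>B. (x \<bullet> b) *\<^sub>R b)" for x
  have p: "p x \<in> V" for x unfolding p_def by (rule is_orthonormal_basis_sum_mem[OF B])
  have "linear (\<lambda>x. l (p x))"
  proof (rule linearI)
    fix x y
    have "p (x + y) = p x + p y"
      by (simp add: p_def inner_add_left scaleR_add_left sum.distrib)
    then show "l (p (x + y)) = l (p x) + l (p y)"
      using l p by (simp add: linear_on_def)
  next
    fix c x
    have "p (c *\<^sub>R x) = c *\<^sub>R p x"
      by (simp add: p_def scaleR_sum_right)
    then show "l (p (c *\<^sub>R x)) = c *\<^sub>R l (p x)"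
      using l p by (simp add: linear_on_def)
  qed
  moreover have "l (p x) = l x" if "x \<in> V" for x
    using is_orthonormal_basis_expand[OF B that] by (simp add: p_def)
  ultimately show ?thesis by (rule that)
qed

text \<open>The operator norm of a linear extension bounds all the quotients. Without boundedness,
  the real supremum in \<open>onorm_on\<close> would carry no information.\<close>

lemma bdd_above_onorm_on:
  assumes l: "linear_on V V' l" and V: "subspace V"
  shows "bdd_above ((\<lambda>x. norm (l x) / norm x) ` V)"
proof -
  obtain l' where l': "linear l'" "\<And>x. x \<in> V \<Longrightarrow> l' x = l x"
    using linear_on_extend[OF l V] by blast
  have "norm (l y) / norm y \<le> onorm l'" if "y \<in> V" for y
    using le_onorm[of l' y] l' that by (simp add: linear_conv_bounded_linear)
  then show ?thesis by (auto intro!: bdd_aboveI)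
qed

lemma onorm_on_bound:
  assumes l: "linear_on V V' l" and V: "subspace V" and x: "x \<in> V"
  shows "norm (l x) \<le> onorm_on V l * norm x"
proof (cases "x = 0")
  case True
  then show ?thesis
    using l x unfolding linear_on_def by (metis mult_zero_right norm_zero order_refl scaleR_zero_left)
next
  case False
  have "norm (l x) / norm x \<le> onorm_on V l"
    unfolding onorm_on_def by (rule cSUP_upper[OF x bdd_above_onorm_on[OF l V]])
  with False show ?thesis by (simp add: divide_le_eq)
qed

lemma onorm_on_nonneg:
  assumes "linear_on V V' l" "subspace V"
  shows "0 \<le> onorm_on V l"
  unfolding onorm_on_def
  by (rule cSUP_upper2[OF bdd_above_onorm_on[OF assms] subspace_0[OF assms(2)]]) simp

text \<open>This transfers the essential rank between a map of the datum and its linear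
  extension.\<close>

lemma ess_rank_cong:
  assumes "\<And>x. x \<in> W \<Longrightarrow> l x = l' x"
  shows "ess_rank \<alpha> l W = ess_rank \<alpha> l' W"
proof -
  have "adjoint_on W l = adjoint_on W l'"
    using assms by (simp add: fun_eq_iff adjoint_on_def cong: conj_cong)
  then have "singular_space W l = singular_space W l'"
    using assms by (auto simp: fun_eq_iff singular_space_def)
  then show ?thesis by (simp add: ess_rank_def singular_values_def)
qed

text \<open>
  A unit vector \<open>u\<close> maximizing \<open>norm (l u)\<close> is a critical point, so \<open>l\<close> maps its orthogonal
  complement into that of \<open>l u\<close>.
\<close>

lemma linear_maximizer_orthogonal:
  fixes l :: "'a::real_inner \<Rightarrow> 'b::real_inner"
  assumes l: "linear l" and W: "subspace W" and u: "u \<in> W" "norm u = 1"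
    and max: "\<And>x. x \<in> W \<Longrightarrow> norm (l x) \<le> norm (l u) * norm x"
    and v: "v \<in> W" "v \<bullet> u = 0"
  shows "l u \<bullet> l v = 0"
proof (rule ccontr)
  define p where "p = l u \<bullet> l v"
  define D where "D = (norm (l v))\<^sup>2 - (norm (l u))\<^sup>2 * (norm v)\<^sup>2"
  assume "l u \<bullet> l v \<noteq> 0"
  then have p: "p \<noteq> 0" by (simp add: p_def)
  have var: "2 * t * p + t\<^sup>2 * D \<le> 0" for t
  proof -
    have "u + t *\<^sub>R v \<in> W" using W u v by (intro subspace_add subspace_scale)
    from power_mono[OF max[OF this], of 2]
    have "(norm (l u + t *\<^sub>R l v))\<^sup>2 \<le> (norm (l u))\<^sup>2 * (norm (u + t *\<^sub>R v))\<^sup>2"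
      by (simp add: power_mult_distrib linear_add[OF l] linear_scale[OF l])
    also have "(norm (l u + t *\<^sub>R l v))\<^sup>2 = (norm (l u))\<^sup>2 + 2 * t * p + t\<^sup>2 * (norm (l v))\<^sup>2"
      unfolding power2_norm_eq_inner
      by (simp add: inner_add_left inner_add_right p_def inner_commute power2_eq_square
          algebra_simps)
    also have "(norm (u + t *\<^sub>R v))\<^sup>2 = 1 + t\<^sup>2 * (norm v)\<^sup>2"
      using u v unfolding power2_norm_eq_inner
      by (simp add: inner_add_left inner_add_right inner_commute power2_eq_square norm_eq_1)
    finally show ?thesis by (simp add: D_def algebra_simps)
  qed
  \<comment> \<open>The value \<open>t = p / m\<close> turns the quadratic expression into
    \<open>p\<close> squared times \<open>2 * m + D\<close>, divided by the square of
    \<open>m\<close>. It is positive since \<open>m\<close> exceeds the absolute value of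
    \<open>D\<close>.\<close>
  define m where "m = \<bar>D\<bar> + 1"
  have m: "m > 0" by (simp add: m_def)
  have "m\<^sup>2 * (2 * (p / m) * p + (p / m)\<^sup>2 * D) \<le> 0"
    by (intro mult_nonneg_nonpos var) simp
  also have "m\<^sup>2 * (2 * (p / m) * p + (p / m)\<^sup>2 * D) = p\<^sup>2 * (2 * m + D)"
    using m by (simp add: field_simps power2_eq_square)
  finally have "p\<^sup>2 * (2 * m + D) \<le> 0" .
  moreover have "2 * m + D > 0" by (simp add: m_def)
  ultimately show False using p by (simp add: mult_le_0_iff)
qed

text \<open>Singular value decomposition by induction on the dimension: a maximizer \<open>u\<close>
  of \<open>norm (l x)\<close> exists on the compact unit sphere of \<open>W\<close>, and the
  induction hypothesis supplies a basis of the complement \<open>W'\<close> of \<open>u\<close>.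
  Being a maximizer, \<open>u\<close> has an image orthogonal to the images of the remaining basis
  vectors.\<close>

lemma exists_singular_basis:
  fixes W :: "'a::euclidean_space set" and l :: "'a \<Rightarrow> 'b::euclidean_space"
  assumes l: "linear l" and W: "subspace W"
  shows "\<exists>B. is_orthonormal_basis W B \<and> pairwise (\<lambda>x y. l x \<bullet> l y = 0) B"
  using W
proof (induction "dim W" arbitrary: W rule: less_induct)
  case less
  show ?case
  proof (cases "W = {0}")
    case True
    then have "is_orthonormal_basis W {}" by (simp add: is_orthonormal_basis_def)
    then show ?thesis by (intro exI[of _ "{}"]) simp
  next
    case False
    then obtain z where z: "z \<in> W" "z \<noteq> 0" using subspace_0[OF less.prems] by blast
    let ?S = "sphere 0 1 \<inter> W"
    have "compact ?S" by (intro compact_Int_closed compact_sphere closed_subspace less.prems)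
    moreover have "z /\<^sub>R norm z \<in> ?S"
      using z less.prems by (auto intro: subspace_scale)
    moreover have "continuous_on ?S (\<lambda>x. norm (l x))"
      using l by (intro continuous_intros linear_continuous_on)
        (simp add: linear_conv_bounded_linear)
    ultimately obtain u where u: "u \<in> ?S" "\<And>x. x \<in> ?S \<Longrightarrow> norm (l x) \<le> norm (l u)"
      using continuous_attains_sup[of ?S "\<lambda>x. norm (l x)"] by blast
    have max: "norm (l x) \<le> norm (l u) * norm x" if "x \<in> W" for x
    proof (cases "x = 0")
      case True then show ?thesis using linear_0[OF l] by simp
    next
      case False
      then have "norm (l (x /\<^sub>R norm x)) \<le> norm (l u)"
        using that less.prems by (intro u(2)) (auto intro: subspace_scale)
      then show ?thesis using False by (simp add: linear_scale[OF l] field_simps)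
    qed
    define W' where "W' = {x \<in> W. \<forall>y\<in>span {u}. x \<bullet> y = 0}"
    have W': "subspace W'" using less.prems by (auto simp: W'_def subspace_def inner_add_left)
    have "u \<notin> W'"
    proof
      assume "u \<in> W'"
      then have "u \<bullet> u = 0" by (auto simp: W'_def span_base)
      then show False using u(1) by simp
    qed
    then have "W' \<subset> W" using u(1) by (auto simp: W'_def)
    then have "dim W' < dim W"
      using W' less.prems by (intro dim_psubset) (simp add: span_eq_iff[THEN iffD2])
    from less.hyps[OF this W'] obtain B
      where B: "is_orthonormal_basis W' B" "pairwise (\<lambda>x y. l x \<bullet> l y = 0) B" by blast
    have "is_orthonormal_basis (span {u}) {u}"
      using u(1) by (simp add: is_orthonormal_basis_def)
    then have "is_orthonormal_basis W ({u} \<union> B)"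
      using B(1) u(1) less.prems unfolding W'_def
      by (intro is_orthonormal_basis_Un(1)) (auto intro: subsetD[OF span_minimal])
    moreover have "l u \<bullet> l b = 0" if "b \<in> B" for b
    proof -
      have "b \<in> W'" using that is_orthonormal_basis_subset[OF B(1)] by blast
      then show ?thesis
        using u(1) max by (intro linear_maximizer_orthogonal[OF l less.prems])
          (auto simp: W'_def span_base)
    qed
    then have "pairwise (\<lambda>x y. l x \<bullet> l y = 0) ({u} \<union> B)"
      using B(2) by (auto simp: pairwise_insert inner_commute)
    ultimately show ?thesis by blast
  qed
qed

text \<open>Expanding both vectors in \<open>B\<close> leaves only the diagonal terms. Hence the
  form is diagonal in \<open>B\<close>, with the squared norms of the \<open>l b\<close> as
  eigenvalues.\<close>

lemma inner_image_singular_basis: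
  fixes l :: "'a::euclidean_space \<Rightarrow> 'b::euclidean_space"
  assumes l: "linear l" and B: "is_orthonormal_basis W B"
    and orth: "pairwise (\<lambda>x y. l x \<bullet> l y = 0) B" and x: "x \<in> W" and y: "y \<in> W"
  shows "l x \<bullet> l y = (\<Sum>b\<in>B. (x \<bullet> b) * (y \<bullet> b) * (norm (l b))\<^sup>2)"
proof -
  have expand: "l z = (\<Sum>b\<in>B. (z \<bullet> b) *\<^sub>R l b)" if "z \<in> W" for z
    by (subst (1) is_orthonormal_basis_expand[OF B that, symmetric])
       (simp add: linear_sum[OF l] linear_scale[OF l])
  have "l b \<bullet> l y = (y \<bullet> b) * (norm (l b))\<^sup>2" if "b \<in> B" for b
  proof -
    have "l b \<bullet> l y = (\<Sum>b'\<in>B. if b' = b then (y \<bullet> b) * (norm (l b))\<^sup>2 else 0)"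
      unfolding expand[OF y] inner_sum_right using orth that
      by (intro sum.cong) (auto simp: pairwise_def power2_norm_eq_inner)
    then show ?thesis using that is_orthonormal_basis_finite[OF B] by simp
  qed
  then show ?thesis
    by (simp add: expand[OF x] inner_sum_left mult.assoc)
qed

lemma singular_space_eq_span:
  fixes l :: "'a::euclidean_space \<Rightarrow> 'b::euclidean_space"
  assumes l: "linear l" and B: "is_orthonormal_basis W B"
    and orth: "pairwise (\<lambda>x y. l x \<bullet> l y = 0) B" and s: "0 \<le> s"
  shows "singular_space W l s = span {b \<in> B. norm (l b) = s}"
proof -
  let ?T = "\<lambda>x. \<Sum>b\<in>B. ((x \<bullet> b) * (norm (l b))\<^sup>2) *\<^sub>R b"
  \<comment> \<open>The adjoint is a definite description, so the explicit vector
    \<open>?T x\<close> must be shown both to satisfy its defining property and to be the only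
    vector that does.\<close>
  have adj: "adjoint_on W l (l x) = ?T x" if x: "x \<in> W" for x
    unfolding adjoint_on_def
  proof (rule the_equality)
    have T: "?T x \<in> W" by (rule is_orthonormal_basis_sum_mem[OF B])
    have eq: "l y \<bullet> l x = y \<bullet> ?T x" if "y \<in> W" for y
      unfolding inner_image_singular_basis[OF l B orth that x] inner_sum_right
      by (intro sum.cong) auto
    with T show "?T x \<in> W \<and> (\<forall>y\<in>W. l y \<bullet> l x = y \<bullet> ?T x)" by blast
    fix z assume z: "z \<in> W \<and> (\<forall>y\<in>W. l y \<bullet> l x = y \<bullet> z)"
    \<comment> \<open>Uniqueness: two candidates have equal inner products with every vector of
      \<open>W\<close>, in particular with their own difference, which is therefore orthogonal to
      itself.\<close>
    then have "z - ?T x \<in> W" using T is_orthonormal_basis_subspace[OF B] by (simp add: subspace_diff)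
    then have "(z - ?T x) \<bullet> z = (z - ?T x) \<bullet> ?T x"
      using bspec[OF conjunct2[OF z]] eq[of "z - ?T x"] by simp
    then have "(z - ?T x) \<bullet> (z - ?T x) = 0" by (simp only: inner_diff_right)
    then show "z = ?T x" by simp
  qed
  show ?thesis
  proof (intro set_eqI iffI)
    fix x assume "x \<in> singular_space W l s"
    then have x: "x \<in> W" and eq: "?T x = s\<^sup>2 *\<^sub>R x"
      by (auto simp: singular_space_def adj)
    have "(x \<bullet> b) *\<^sub>R b \<in> span {b \<in> B. norm (l b) = s}" if b: "b \<in> B" for b
    proof (cases "norm (l b) = s")
      case True with b show ?thesis by (auto intro: span_scale span_base)
    next
      case False
      \<comment> \<open>Comparing coordinates along \<open>b\<close> in the eigenvalue equation:
        distinct nonnegative numbers have distinct squares, which forces the coordinate to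
        vanish.\<close>
      have "(x \<bullet> b) * (norm (l b))\<^sup>2 = s\<^sup>2 * (x \<bullet> b)"
        using arg_cong[OF eq, of "\<lambda>v. v \<bullet> b"]
          is_orthonormal_basis_sum_inner[OF B b, of "\<lambda>b. (x \<bullet> b) * (norm (l b))\<^sup>2"] by simp
      moreover have "(norm (l b))\<^sup>2 \<noteq> s\<^sup>2" using False s by simp
      ultimately have "x \<bullet> b = 0" by simp
      then show ?thesis by (simp add: span_zero)
    qed
    then have "(\<Sum>b\<in>B. (x \<bullet> b) *\<^sub>R b) \<in> span {b \<in> B. norm (l b) = s}" by (rule span_sum)
    then show "x \<in> span {b \<in> B. norm (l b) = s}"
      by (simp add: is_orthonormal_basis_expand[OF B x])
  next
    fix x assume xs: "x \<in> span {b \<in> B. norm (l b) = s}"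
    then have x: "x \<in> W"
      using B span_mono[of "{b \<in> B. norm (l b) = s}" B] by (auto simp: is_orthonormal_basis_def)
    have "x \<bullet> b = 0" if b: "b \<in> B" "norm (l b) \<noteq> s" for b
    proof -
      have "orthogonal b x"
        using b is_orthonormal_basis_inner[OF B b(1)]
        by (intro orthogonal_to_span[OF xs]) (auto simp: orthogonal_def)
      then show ?thesis by (simp add: orthogonal_def inner_commute)
    qed
    then have "?T x = (\<Sum>b\<in>B. s\<^sup>2 *\<^sub>R ((x \<bullet> b) *\<^sub>R b))"
      by (intro sum.cong) (auto simp: mult.commute)
    also have "\<dots> = s\<^sup>2 *\<^sub>R x"
      by (simp only: scaleR_sum_right[symmetric] is_orthonormal_basis_expand[OF B x])
    finally show "x \<in> singular_space W l s" using x by (simp add: singular_space_def adj)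
  qed
qed

text \<open>Grouping the vectors of \<open>B\<close> by the value of \<open>norm (l b)\<close>
  produces one group for each singular value, whose size is the dimension of the singular space.
  Counting the groups above \<alpha> with multiplicity then counts basis vectors.\<close>

lemma ess_rank_singular_basis:
  fixes l :: "'a::euclidean_space \<Rightarrow> 'b::euclidean_space"
  assumes l: "linear l" and B: "is_orthonormal_basis W B"
    and orth: "pairwise (\<lambda>x y. l x \<bullet> l y = 0) B" and \<alpha>: "0 \<le> \<alpha>"
  shows "ess_rank \<alpha> l W = card {b \<in> B. \<alpha> < norm (l b)}"
proof -
  let ?A = "{b \<in> B. \<alpha> < norm (l b)}"
  have fin: "finite ?A" using is_orthonormal_basis_finite[OF B] by simp
  note sp = singular_space_eq_span[OF l B orth]
  have "s \<in> singular_values W l \<longleftrightarrow> (\<exists>b\<in>B. norm (l b) = s)" if "0 \<le> s" for s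
  proof
    assume "s \<in> singular_values W l"
    then obtain x where x: "x \<in> span {b \<in> B. norm (l b) = s}" "x \<noteq> 0"
      by (auto simp: singular_values_def sp)
    show "\<exists>b\<in>B. norm (l b) = s"
    proof (rule ccontr)
      assume "\<not> (\<exists>b\<in>B. norm (l b) = s)"
      then have "{b \<in> B. norm (l b) = s} = {}" by blast
      with x show False by simp
    qed
  next
    assume "\<exists>b\<in>B. norm (l b) = s"
    then obtain b where "b \<in> B" "norm (l b) = s" by blast
    moreover from this have "b \<noteq> 0" using is_orthonormal_basis_inner[OF B, of b b] by auto
    ultimately show "s \<in> singular_values W l"
      using that by (auto simp: singular_values_def sp span_base intro!: bexI[of _ b])
  qed
  then have vals: "{s \<in> singular_values W l. \<alpha> < s} = (\<lambda>b. norm (l b)) ` ?A"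
    using \<alpha> by (auto simp: image_iff)
  have "dim (singular_space W l s) = (\<Sum>b | b \<in> ?A \<and> norm (l b) = s. 1)" if "\<alpha> < s" for s
  proof -
    have "dim (singular_space W l s) = card {b \<in> B. norm (l b) = s}"
      using that \<alpha> is_orthonormal_basis_card[OF is_orthonormal_basis_span[OF B]]
      by (simp add: sp)
    also have "{b \<in> B. norm (l b) = s} = {b \<in> ?A. norm (l b) = s}" using that by auto
    finally show ?thesis by simp
  qed
  then have "ess_rank \<alpha> l W = (\<Sum>s\<in>(\<lambda>b. norm (l b)) ` ?A. \<Sum>b | b \<in> ?A \<and> norm (l b) = s. 1)"
    unfolding ess_rank_def vals by (intro sum.cong) auto
  also have "\<dots> = (\<Sum>b\<in>?A. 1)" by (rule sum.image_gen[OF fin, symmetric])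
  finally show ?thesis by simp
qed

section \<open>The Gaussian lower bound\<close>

text \<open>
  The weight \<open>\<alpha>\<close> is put on the span \<open>E\<close> of the images of the singular vectors with singular value
  above \<open>\<alpha>\<close>, and 1 on its complement in \<open>V\<close>. Writing \<open>T\<close> for the weighting and splitting \<open>w = w1 + w2\<close>
  along large and small singular values, \<open>l w2\<close> is already bounded by \<open>\<alpha> * norm w2\<close>, while
  \<open>(norm (T y))\<^sup>2\<close> is the combination of \<open>(norm y)\<^sup>2\<close> and the squared distance from \<open>y\<close> to \<open>E\<close> with
  coefficients \<open>\<alpha>\<^sup>2\<close> and \<open>1 - \<alpha>\<^sup>2\<close>; for \<open>y = l (w1 + v)\<close> that distance only sees \<open>l v\<close>.
\<close>

lemma weighted_orthonormal_basis_exists: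
  fixes l :: "'a::euclidean_space \<Rightarrow> 'b::euclidean_space"
  assumes l: "linear l" and H: "subspace H" and W: "subspace W" "W \<subseteq> H"
    and V: "subspace V" "l ` H \<subseteq> V"
    and L: "0 \<le> L" "\<And>x. x \<in> H \<Longrightarrow> norm (l x) \<le> L * norm x"
    and \<alpha>: "0 < \<alpha>" "\<alpha> \<le> 1"
  shows "\<exists>B t. is_orthonormal_basis V B \<and> (\<forall>b\<in>B. 0 < t b)
    \<and> (\<Prod>b\<in>B. 1 / t b) = (1 / \<alpha>) ^ ess_rank \<alpha> l W
    \<and> (\<forall>w\<in>W. \<forall>v\<in>H. (\<forall>x\<in>W. v \<bullet> x = 0) \<longrightarrow>
          (norm (\<Sum>b\<in>B. (t b * (l (w + v) \<bullet> b)) *\<^sub>R b))\<^sup>2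
            \<le> (1 + L)\<^sup>2 * (\<alpha>\<^sup>2 * (norm w)\<^sup>2 + (norm v)\<^sup>2))"
proof -
  obtain S where S: "is_orthonormal_basis W S" and orth: "pairwise (\<lambda>x y. l x \<bullet> l y = 0) S"
    using exists_singular_basis[OF l W(1)] by blast
  define S1 where "S1 = {b \<in> S. \<alpha> < norm (l b)}"
  define F where "F = (\<lambda>b. l b /\<^sub>R norm (l b)) ` S1"
  have finS: "finite S" by (rule is_orthonormal_basis_finite[OF S])
  have S1: "S1 \<subseteq> S" "\<And>b. b \<in> S1 \<Longrightarrow> norm (l b) > 0"
    using \<alpha>(1) by (auto simp: S1_def simp del: zero_less_norm_iff)
  have orth1: "l b \<bullet> l b' = 0" if "b \<in> S1" "b' \<in> S1" "b \<noteq> b'" for b b'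
    using that orth S1(1) by (auto simp: pairwise_def)
  \<comment> \<open>Injectivity ensures that \<open>F\<close> has as many elements as
    \<open>S1\<close>, hence that its cardinality is the essential rank.\<close>
  have inj: "inj_on (\<lambda>b. l b /\<^sub>R norm (l b)) S1"
  proof (rule inj_onI, rule ccontr)
    fix b b' assume b: "b \<in> S1" "b' \<in> S1" "b \<noteq> b'" and eq: "l b /\<^sub>R norm (l b) = l b' /\<^sub>R norm (l b')"
    have "(l b /\<^sub>R norm (l b)) \<bullet> (l b' /\<^sub>R norm (l b')) = 0" using orth1[OF b] by simp
    then have "l b' /\<^sub>R norm (l b') = 0" unfolding eq by (simp only: inner_eq_zero_iff)
    then show False using S1(2)[OF b(2)] by simp
  qed
  have F: "is_orthonormal_basis (span F) F"
    unfolding is_orthonormal_basis_def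
  proof (intro conjI ballI refl)
    show "pairwise orthogonal F"
      using orth1 by (fastforce simp: F_def pairwise_def orthogonal_def)
    show "norm f = 1" if "f \<in> F" for f
      using that S1(2) by (auto simp: F_def)
  qed
  have lV: "l x \<in> V" if "x \<in> H" for x using V(2) that by blast
  have SW: "S \<subseteq> W" by (rule is_orthonormal_basis_subset[OF S])
  have "F \<subseteq> V" using SW S1(1) W(2) V(1) lV by (force simp: F_def intro!: subspace_scale)
  then have "span F \<subseteq> V" by (intro span_minimal V(1))
  then obtain B where B: "is_orthonormal_basis V B" "F \<subseteq> B"
    using is_orthonormal_basis_extend[OF F V(1)] by blast
  have fin: "finite B" by (rule is_orthonormal_basis_finite[OF B(1)])
  define t where "t b = (if b \<in> F then \<alpha> else 1)" for b
  have t: "0 < t b" "t b \<le> 1" for b using \<alpha> by (auto simp: t_def)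
  have "(\<Prod>b\<in>B. 1 / t b) = (\<Prod>b\<in>B. if b \<in> F then 1 / \<alpha> else 1)"
    by (intro prod.cong) (auto simp: t_def)
  also have "\<dots> = (1 / \<alpha>) ^ card F"
    using fin B(2) by (simp add: prod.If_cases Int_absorb1)
  also have "card F = ess_rank \<alpha> l W"
    using ess_rank_singular_basis[OF l S orth, of \<alpha>] \<alpha>(1) card_image[OF inj]
    by (simp add: F_def S1_def)
  finally have prod: "(\<Prod>b\<in>B. 1 / t b) = (1 / \<alpha>) ^ ess_rank \<alpha> l W" .
  define T where "T y = (\<Sum>b\<in>B. (t b * (y \<bullet> b)) *\<^sub>R b)" for y
  have T_add: "T (x + y) = T x + T y" for x y
    by (simp add: T_def inner_add_left distrib_left scaleR_add_left sum.distrib)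
  have T_norm: "(norm (T y))\<^sup>2 = (\<Sum>b\<in>B. (t b)\<^sup>2 * (y \<bullet> b)\<^sup>2)" for y
    unfolding T_def is_orthonormal_basis_norm_sum[OF B(1)] by (simp add: power_mult_distrib)
  have T_le: "norm (T y) \<le> norm y" if "y \<in> V" for y
  proof -
    have "(norm (T y))\<^sup>2 \<le> (\<Sum>b\<in>B. (y \<bullet> b)\<^sup>2)"
      unfolding T_norm using t by (intro sum_mono mult_left_le_one_le)
        (auto simp: power_le_one less_imp_le)
    then show ?thesis
      unfolding is_orthonormal_basis_norm[OF B(1) that, symmetric] by (rule power2_le_imp_le) simp
  qed
  have T_split: "(norm (T y))\<^sup>2 = \<alpha>\<^sup>2 * (norm y)\<^sup>2 + (1 - \<alpha>\<^sup>2) * (\<Sum>b\<in>B - F. (y \<bullet> b)\<^sup>2)"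
    if "y \<in> V" for y
    unfolding T_norm is_orthonormal_basis_norm[OF B(1) that] sum.subset_diff[OF B(2) fin]
    by (simp add: t_def sum_distrib_left[symmetric] algebra_simps)
  have "(norm (T (l (w + v))))\<^sup>2 \<le> (1 + L)\<^sup>2 * (\<alpha>\<^sup>2 * (norm w)\<^sup>2 + (norm v)\<^sup>2)"
    if w: "w \<in> W" and v: "v \<in> H" "\<forall>x\<in>W. v \<bullet> x = 0" for w v
  proof -
    define w1 where "w1 = (\<Sum>b\<in>S1. (w \<bullet> b) *\<^sub>R b)"
    define w2 where "w2 = (\<Sum>b\<in>S - S1. (w \<bullet> b) *\<^sub>R b)"
    have S1': "is_orthonormal_basis (span S1) S1"
      and S2': "is_orthonormal_basis (span (S - S1)) (S - S1)"
      using is_orthonormal_basis_span[OF S] S1(1) by auto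
    have "w1 \<in> span S1" "w2 \<in> span (S - S1)"
      unfolding w1_def w2_def
      by (rule is_orthonormal_basis_sum_mem[OF S1'] is_orthonormal_basis_sum_mem[OF S2'])+
    moreover have "span S1 \<subseteq> W" "span (S - S1) \<subseteq> W"
      by (rule span_minimal[OF _ W(1)], use SW S1(1) in blast)+
    ultimately have wW: "w1 \<in> W" "w2 \<in> W" by auto
    then have wH: "w1 \<in> H" "w2 \<in> H" using W(2) by auto
    have w_eq: "w = w1 + w2"
      unfolding w1_def w2_def
      by (subst (1) is_orthonormal_basis_expand[OF S w, symmetric])
         (simp add: sum.subset_diff[OF S1(1) finS] add.commute)
    have norm_w1: "(norm w1)\<^sup>2 = (\<Sum>b\<in>S1. (w \<bullet> b)\<^sup>2)"
      unfolding w1_def by (rule is_orthonormal_basis_norm_sum[OF S1'])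
    have norm_w2: "(norm w2)\<^sup>2 = (\<Sum>b\<in>S - S1. (w \<bullet> b)\<^sup>2)"
      unfolding w2_def by (rule is_orthonormal_basis_norm_sum[OF S2'])
    have norm_w: "(norm w)\<^sup>2 = (norm w1)\<^sup>2 + (norm w2)\<^sup>2"
      unfolding norm_w1 norm_w2 is_orthonormal_basis_norm[OF S w]
      by (simp add: sum.subset_diff[OF S1(1) finS] add.commute)
    have w2b: "w2 \<bullet> b = (if b \<in> S1 then 0 else w \<bullet> b)" if "b \<in> S" for b
    proof (cases "b \<in> S1")
      case True
      have "w2 \<bullet> b = 0"
        unfolding w2_def inner_sum_left using is_orthonormal_basis_inner[OF S _ that] True
        by (intro sum.neutral) auto
      with True show ?thesis by simp
    next
      case False
      then show ?thesis
        using that is_orthonormal_basis_sum_inner[OF S2', of b "\<lambda>b. w \<bullet> b"] by (simp add: w2_def)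
    qed
    \<comment> \<open>Only basis vectors outside \<open>S1\<close>, where \<open>norm (l b)\<close>
      is at most \<alpha>, carry coordinates of \<open>w2\<close>.\<close>
    have "(norm (l w2))\<^sup>2 = (\<Sum>b\<in>S. (w2 \<bullet> b)\<^sup>2 * (norm (l b))\<^sup>2)"
      unfolding power2_norm_eq_inner[of "l w2"]
        inner_image_singular_basis[OF l S orth wW(2) wW(2)]
      by (simp only: power2_eq_square[of "w2 \<bullet> _"])
    also have "\<dots> \<le> (\<Sum>b\<in>S. (w2 \<bullet> b)\<^sup>2 * \<alpha>\<^sup>2)"
    proof (rule sum_mono)
      fix b assume b: "b \<in> S"
      show "(w2 \<bullet> b)\<^sup>2 * (norm (l b))\<^sup>2 \<le> (w2 \<bullet> b)\<^sup>2 * \<alpha>\<^sup>2"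
      proof (cases "b \<in> S1")
        case True then show ?thesis by (simp add: w2b[OF b])
      next
        case False
        then show ?thesis using b by (intro mult_left_mono power_mono) (auto simp: S1_def)
      qed
    qed
    also have "\<dots> = (\<alpha> * norm w2)\<^sup>2"
      by (simp add: is_orthonormal_basis_norm[OF S wW(2)] power_mult_distrib
          sum_distrib_left mult.commute)
    finally have lw2: "norm (l w2) \<le> \<alpha> * norm w2"
      by (rule power2_le_imp_le) (use \<alpha> in simp)
    \<comment> \<open>\<open>R\<close> is the square root of the target quadratic form. The two
      pieces are bounded by \<open>L * R\<close> and \<open>R\<close>, so the triangle inequality
      yields \<open>1 + L\<close>; this is the origin of the summand 1 in \<open>C\<close>.\<close>
    define R where "R = sqrt (\<alpha>\<^sup>2 * (norm w)\<^sup>2 + (norm v)\<^sup>2)"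
    have R2: "R\<^sup>2 = \<alpha>\<^sup>2 * (norm w)\<^sup>2 + (norm v)\<^sup>2" and R0: "0 \<le> R" by (simp_all add: R_def)
    have "norm (T (l w2)) \<le> \<alpha> * norm w2"
      using T_le[OF lV[OF wH(2)]] lw2 by linarith
    also have "\<dots> \<le> R"
      unfolding R_def
      by (rule real_le_rsqrt) (simp add: norm_w power_mult_distrib distrib_left)
    finally have small: "norm (T (l w2)) \<le> R" .
    have wv: "w1 + v \<in> H" using wH(1) v(1) H by (simp add: subspace_add)
    have "v \<bullet> w1 = 0" using v(2) wW(1) by blast
    then have norm_wv: "(norm (w1 + v))\<^sup>2 = (norm w1)\<^sup>2 + (norm v)\<^sup>2"
      unfolding power2_norm_eq_inner by (simp add: inner_add_left inner_add_right inner_commute)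
    have "l w1 \<in> span F"
      unfolding w1_def linear_sum[OF l] linear_scale[OF l]
    proof (intro span_sum span_scale)
      fix b assume b: "b \<in> S1"
      then have "norm (l b) *\<^sub>R (l b /\<^sub>R norm (l b)) \<in> span F"
        by (intro span_scale span_base) (simp add: F_def)
      then show "l b \<in> span F" using S1(2)[OF b] by simp
    qed
    then have "l w1 \<bullet> b = 0" if "b \<in> B - F" for b
    proof -
      have "orthogonal b (l w1)"
      proof (rule orthogonal_to_span[OF \<open>l w1 \<in> span F\<close>])
        fix f assume "f \<in> F"
        then have "f \<in> B" "f \<noteq> b" using B(2) that by auto
        then show "orthogonal b f"
          using is_orthonormal_basis_inner[OF B(1), of b f] that by (simp add: orthogonal_def)
      qed
      then show ?thesis by (simp add: orthogonal_def inner_commute)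
    qed
    then have "(\<Sum>b\<in>B - F. (l (w1 + v) \<bullet> b)\<^sup>2) = (\<Sum>b\<in>B - F. (l v \<bullet> b)\<^sup>2)"
      by (intro sum.cong) (auto simp: linear_add[OF l] inner_add_left)
    also have "\<dots> \<le> (norm (l v))\<^sup>2"
      unfolding is_orthonormal_basis_norm[OF B(1) lV[OF v(1)]] using fin
      by (intro sum_mono2) auto
    also have "\<dots> \<le> (L * norm v)\<^sup>2"
      by (intro power_mono L(2) v(1)) simp
    finally have far: "(\<Sum>b\<in>B - F. (l (w1 + v) \<bullet> b)\<^sup>2) \<le> L\<^sup>2 * (norm v)\<^sup>2"
      by (simp add: power_mult_distrib)
    have near: "(norm (l (w1 + v)))\<^sup>2 \<le> L\<^sup>2 * ((norm w1)\<^sup>2 + (norm v)\<^sup>2)"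
      using power_mono[OF L(2)[OF wv], of 2] by (simp add: power_mult_distrib norm_wv)
    have "(norm (T (l (w1 + v))))\<^sup>2
        \<le> \<alpha>\<^sup>2 * (L\<^sup>2 * ((norm w1)\<^sup>2 + (norm v)\<^sup>2)) + (1 - \<alpha>\<^sup>2) * (L\<^sup>2 * (norm v)\<^sup>2)"
      unfolding T_split[OF lV[OF wv]] using \<alpha>
      by (intro add_mono mult_left_mono near far) (auto simp: power_le_one)
    \<comment> \<open>The two coefficients of the \<open>v\<close> terms add up to 1, whereas the
      \<open>w1\<close> term keeps the small factor.\<close>
    also have "\<dots> = L\<^sup>2 * (\<alpha>\<^sup>2 * (norm w1)\<^sup>2 + (norm v)\<^sup>2)"
      by (simp add: algebra_simps)
    also have "\<dots> \<le> L\<^sup>2 * R\<^sup>2"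
      unfolding R2 norm_w by (intro mult_left_mono) (auto simp: distrib_left)
    finally have "(norm (T (l (w1 + v))))\<^sup>2 \<le> (L * R)\<^sup>2" by (simp add: power_mult_distrib)
    then have "norm (T (l (w1 + v))) \<le> L * R"
      by (rule power2_le_imp_le) (use L R0 in simp)
    moreover have "l (w + v) = l (w1 + v) + l w2"
      by (simp add: w_eq linear_add[OF l])
    ultimately have "norm (T (l (w + v))) \<le> (1 + L) * R"
      using small norm_triangle_ineq[of "T (l (w1 + v))" "T (l w2)"]
      by (simp add: T_add distrib_right)
    then have "(norm (T (l (w + v))))\<^sup>2 \<le> ((1 + L) * R)\<^sup>2" by (rule power_mono) (rule norm_ge_zero)
    then show ?thesis by (simp add: power_mult_distrib R2)
  qed
  then show ?thesis
    using B(1) t(1) prod unfolding T_def by blast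
qed

lemma ennreal_powr_ennreal:
  assumes "0 < x" shows "ennreal_powr (ennreal x) p = ennreal (x powr p)"
  using assms by (simp add: ennreal_powr_def)

text \<open>
  The constant \<open>C\<^sup>2 * (\<Sum>j\<in>J. q j)\<close> is relaxed to any larger \<open>k > 0\<close>: when \<open>J\<close> is empty it vanishes,
  and the theorem is the limit \<open>k \<rightarrow> 0\<close>.
\<close>

lemma is_BL_bound_ge:
  fixes K :: "'j \<Rightarrow> 'b::euclidean_space set" and H W :: "'a::euclidean_space set"
  assumes D: "brascamp_lieb_datum J H K l q"
    and W: "subspace W" "W \<subseteq> H" and \<alpha>: "0 < \<alpha>" "\<alpha> \<le> 1"
    and C: "1 \<le> C" "\<And>j x. j \<in> J \<Longrightarrow> x \<in> H \<Longrightarrow> norm (l j x) \<le> (C - 1) * norm x"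
    and k: "0 < k" "C\<^sup>2 * (\<Sum>j\<in>J. q j) \<le> k"
    and c: "is_BL_bound J H K l q c"
  shows "ennreal (k powr (- (real (dim H) / 2)) *
    \<alpha> powr ((\<Sum>j\<in>J. q j * real (ess_rank \<alpha> (l j) W)) - real (dim W))) \<le> c"
proof -
  interpret brascamp_lieb_datum J H K l q by (rule D)
  define r where "r j = ess_rank \<alpha> (l j) W" for j
  \<comment> \<open>Naming the property allows the basis and the weights to be chosen for all
    \<open>j\<close> at once. The constant \<open>C\<close> stands for \<open>1 + L\<close> with
    \<open>L = C - 1\<close>.\<close>
  define P where "P j B t \<longleftrightarrow> is_orthonormal_basis (K j) B \<and> (\<forall>b\<in>B. 0 < t b)
    \<and> (\<Prod>b\<in>B. 1 / t b) = (1 / \<alpha>) ^ r j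
    \<and> (\<forall>w\<in>W. \<forall>v\<in>H. (\<forall>x\<in>W. v \<bullet> x = 0) \<longrightarrow>
          (norm (\<Sum>b\<in>B. (t b * (l j (w + v) \<bullet> b)) *\<^sub>R b))\<^sup>2
            \<le> C\<^sup>2 * (\<alpha>\<^sup>2 * (norm w)\<^sup>2 + (norm v)\<^sup>2))" for j B t
  have "\<exists>B t. P j B t" if j: "j \<in> J" for j
  proof -
    obtain l' where l': "linear l'" "\<And>x. x \<in> H \<Longrightarrow> l' x = l j x"
      using linear_on_extend[OF linear_map[OF j] subspace_domain] by blast
    have "l' ` H \<subseteq> K j"
      using linear_map[OF j] l'(2) by (auto simp: linear_on_def)
    moreover have "norm (l' x) \<le> (C - 1) * norm x" if "x \<in> H" for x
      using C(2)[OF j that] l'(2)[OF that] by simp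
    moreover have "0 \<le> C - 1" using C(1) by simp
    moreover have "ess_rank \<alpha> l' W = r j"
      unfolding r_def using l'(2) W(2) by (intro ess_rank_cong) auto
    moreover have "l' (w + v) = l j (w + v)" if "w \<in> W" "v \<in> H" for w v
      using that W(2) subspace_domain by (intro l'(2) subspace_add) auto
    ultimately show ?thesis
      unfolding P_def
      using weighted_orthonormal_basis_exists
        [OF l'(1) subspace_domain W subspace_codomain[OF j], of "C - 1" \<alpha>] \<alpha>
      by simp
  qed
  then obtain B t where "\<And>j. j \<in> J \<Longrightarrow> P j (B j) (t j)" by metis
  then have B: "\<And>j. j \<in> J \<Longrightarrow> is_orthonormal_basis (K j) (B j)"
    and t: "\<And>j b. j \<in> J \<Longrightarrow> b \<in> B j \<Longrightarrow> 0 < t j b"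
    and prod_t: "\<And>j. j \<in> J \<Longrightarrow> (\<Prod>b\<in>B j. 1 / t j b) = (1 / \<alpha>) ^ r j"
    and est: "\<And>j w v. \<lbrakk>j \<in> J; w \<in> W; v \<in> H; \<forall>x\<in>W. v \<bullet> x = 0\<rbrakk> \<Longrightarrow>
          (norm (\<Sum>b\<in>B j. (t j b * (l j (w + v) \<bullet> b)) *\<^sub>R b))\<^sup>2
            \<le> C\<^sup>2 * (\<alpha>\<^sup>2 * (norm w)\<^sup>2 + (norm v)\<^sup>2)"
    unfolding P_def by blast+
  define Q where "Q j y = (norm (\<Sum>b\<in>B j. (t j b * (y \<bullet> b)) *\<^sub>R b))\<^sup>2" for j y
  define f where "f j y = exp (- pi * Q j y)" for j y
  have f_meas: "f j \<in> borel_measurable (subspace_lborel (K j))" for j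
  proof -
    have "f j \<in> borel_measurable borel" unfolding f_def Q_def by measurable
    then show ?thesis
      by (simp add: measurable_restrict_space1 measurable_cong_sets[OF sets_subspace_lborel refl])
  qed
  have "(\<integral>\<^sup>+ y. ennreal (f j y) \<partial>subspace_lborel (K j)) = ennreal ((1 / \<alpha>) ^ r j)"
    if "j \<in> J" for j
    unfolding f_def Q_def prod_t[OF that, symmetric]
    by (rule nn_integral_subspace_gaussian[OF B[OF that] t[OF that]])
  then have "ennreal_powr (\<integral>\<^sup>+ y. ennreal (f j y) \<partial>subspace_lborel (K j)) (q j)
      = ennreal (\<alpha> powr (- (q j * real (r j))))" if "j \<in> J" for j
    using that \<alpha>(1)
    by (simp add: ennreal_powr_ennreal powr_realpow[symmetric] powr_powr powr_divide powr_minus_divide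
        mult.commute)
  then have "(\<Prod>j\<in>J. ennreal_powr (\<integral>\<^sup>+ y. ennreal (f j y) \<partial>subspace_lborel (K j)) (q j))
      = (\<Prod>j\<in>J. ennreal (\<alpha> powr (- (q j * real (r j)))))"
    by (rule prod.cong[OF refl])
  also have "\<dots> = ennreal (\<alpha> powr (- (\<Sum>j\<in>J. q j * real (r j))))"
    using \<alpha>(1) finite_index by (simp add: prod_ennreal powr_sum sum_negf[symmetric])
  finally have upper: "(\<integral>\<^sup>+ x. ennreal (\<Prod>j\<in>J. f j (l j x) powr q j) \<partial>subspace_lborel H)
      \<le> c * ennreal (\<alpha> powr (- (\<Sum>j\<in>J. q j * real (r j))))"
    using c[unfolded is_BL_bound_def, rule_format, of f] f_meas by (simp add: f_def)

  obtain G where G: "is_orthonormal_basis W G" using is_orthonormal_basis_exists[OF W(1)] by blast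
  define W' where "W' = {x \<in> H. \<forall>w\<in>W. x \<bullet> w = 0}"
  have "subspace W'" using subspace_domain by (auto simp: W'_def subspace_def inner_add_left)
  then obtain G' where G': "is_orthonormal_basis W' G'" using is_orthonormal_basis_exists by blast
  have GG: "is_orthonormal_basis H (G \<union> G')" and disj: "G \<inter> G' = {}"
    using is_orthonormal_basis_Un[OF G subspace_domain W(2)] G' by (simp_all add: W'_def)
  have fin: "finite G" "finite G'" using G G' by (auto intro: is_orthonormal_basis_finite)
  \<comment> \<open>These weights produce the comparison Gaussian on \<open>H\<close>: the squared
    norm in its exponent is \<open>k\<close> times the form with weight
    \<open>\<alpha>\<^sup>2\<close> on \<open>W\<close> and 1 on the complement. Each basis vector
    contributes \<open>1 / sqrt k\<close> to the integral, and each vector of \<open>G\<close> a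
    further \<open>1 / \<alpha>\<close>.\<close>
  define u where "u b = sqrt k * (if b \<in> G then \<alpha> else 1)" for b
  have u: "0 < u b" for b using k(1) \<alpha> by (simp add: u_def)
  have lower: "exp (- pi * (norm (\<Sum>b\<in>G \<union> G'. (u b * (x \<bullet> b)) *\<^sub>R b))\<^sup>2)
      \<le> (\<Prod>j\<in>J. f j (l j x) powr q j)" if x: "x \<in> H" for x
  proof -
    define w where "w = (\<Sum>b\<in>G. (x \<bullet> b) *\<^sub>R b)"
    define v where "v = (\<Sum>b\<in>G'. (x \<bullet> b) *\<^sub>R b)"
    have w: "w \<in> W" and v: "v \<in> W'"
      unfolding w_def v_def
      by (rule is_orthonormal_basis_sum_mem[OF G] is_orthonormal_basis_sum_mem[OF G'])+
    have x_eq: "x = w + v"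
      unfolding w_def v_def
      by (subst (1) is_orthonormal_basis_expand[OF GG x, symmetric])
         (simp add: sum.union_disjoint[OF fin disj])
    let ?E = "\<alpha>\<^sup>2 * (norm w)\<^sup>2 + (norm v)\<^sup>2"
    have "(\<Sum>b\<in>G'. (u b * (x \<bullet> b))\<^sup>2) = k * (norm v)\<^sup>2"
      using disj k(1) unfolding v_def is_orthonormal_basis_norm_sum[OF G'] sum_distrib_left
      by (intro sum.cong) (auto simp: u_def power_mult_distrib)
    moreover have "(\<Sum>b\<in>G. (u b * (x \<bullet> b))\<^sup>2) = k * (\<alpha>\<^sup>2 * (norm w)\<^sup>2)"
      using k(1) unfolding w_def is_orthonormal_basis_norm_sum[OF G] sum_distrib_left
      by (intro sum.cong) (auto simp: u_def power_mult_distrib)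
    ultimately have norm_eq: "(norm (\<Sum>b\<in>G \<union> G'. (u b * (x \<bullet> b)) *\<^sub>R b))\<^sup>2 = k * ?E"
      unfolding is_orthonormal_basis_norm_sum[OF GG]
      by (simp add: sum.union_disjoint[OF fin disj] distrib_left)
    \<comment> \<open>Raising \<open>f j\<close> to the power \<open>q j\<close> multiplies its
      exponent by \<open>q j\<close>, so the forms add up with these weights. The common bound for
      them then brings in the hypothesis on \<open>k\<close>.\<close>
    have "(\<Sum>j\<in>J. q j * Q j (l j x)) \<le> (\<Sum>j\<in>J. q j * (C\<^sup>2 * ?E))"
      using w v unfolding Q_def x_eq
      by (intro sum_mono mult_left_mono est) (auto simp: W'_def exponent_pos less_imp_le)
    also have "\<dots> = C\<^sup>2 * (\<Sum>j\<in>J. q j) * ?E"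
      by (simp add: sum_distrib_right[symmetric])
    also have "\<dots> \<le> k * ?E"
      by (intro mult_right_mono k(2)) simp
    finally have "- pi * (k * ?E) \<le> - pi * (\<Sum>j\<in>J. q j * Q j (l j x))" by simp
    then have "exp (- pi * (k * ?E)) \<le> exp (\<Sum>j\<in>J. q j * (- pi * Q j (l j x)))"
      by (simp add: sum_distrib_left sum_negf mult.left_commute)
    also have "\<dots> = (\<Prod>j\<in>J. f j (l j x) powr q j)"
      by (simp add: exp_sum[OF finite_index] f_def powr_def)
    finally show ?thesis by (simp only: norm_eq)
  qed

  have dims: "card G = dim W" "card (G \<union> G') = dim H"
    using G GG by (auto intro: is_orthonormal_basis_card)
  have "(\<Prod>b\<in>G \<union> G'. 1 / u b) = (\<Prod>b\<in>G \<union> G'. 1 / sqrt k) * (\<Prod>b\<in>G \<union> G'. if b \<in> G then 1 / \<alpha> else 1)"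
    by (simp only: prod.distrib[symmetric]) (auto intro: prod.cong simp: u_def)
  also have "(\<Prod>b\<in>G \<union> G'. if b \<in> G then 1 / \<alpha> else 1) = (1 / \<alpha>) ^ card G"
    using fin by (simp add: prod.If_cases Int_absorb1)
  also have "(1 / \<alpha>) ^ card G = \<alpha> powr (- real (dim W))"
    using \<alpha>(1) by (simp add: dims powr_minus powr_realpow power_one_over inverse_eq_divide)
  also have "(\<Prod>b\<in>G \<union> G'. 1 / sqrt k) = k powr (- (real (dim H) / 2))"
  proof -
    have "1 / sqrt k = k powr (- (1 / 2))"
      using k(1) by (simp add: powr_minus powr_half_sqrt inverse_eq_divide)
    then have "(\<Prod>b\<in>G \<union> G'. 1 / sqrt k) = (k powr (- (1 / 2))) powr real (dim H)"
      using k(1) by (simp add: dims powr_realpow)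
    then show ?thesis by (simp add: powr_powr)
  qed
  finally have prod_u: "(\<Prod>b\<in>G \<union> G'. 1 / u b) = k powr (- (real (dim H) / 2)) * \<alpha> powr (- real (dim W))" .

  let ?m = "\<Sum>j\<in>J. q j * real (r j)"
  have "ennreal (k powr (- (real (dim H) / 2)) * \<alpha> powr (- real (dim W)))
      = (\<integral>\<^sup>+ x. ennreal (exp (- pi * (norm (\<Sum>b\<in>G \<union> G'. (u b * (x \<bullet> b)) *\<^sub>R b))\<^sup>2)) \<partial>subspace_lborel H)"
    by (simp only: nn_integral_subspace_gaussian[OF GG u] prod_u)
  also have "\<dots> \<le> (\<integral>\<^sup>+ x. ennreal (\<Prod>j\<in>J. f j (l j x) powr q j) \<partial>subspace_lborel H)"
    by (intro nn_integral_mono ennreal_leI lower) simp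
  also note upper
  \<comment> \<open>Multiplying both sides by the reciprocal of the factor next to \<open>c\<close>
    avoids a division in \<open>ennreal\<close>, where \<open>c\<close> may be infinite.\<close>
  finally have "ennreal (\<alpha> powr ?m) * ennreal (k powr (- (real (dim H) / 2)) * \<alpha> powr (- real (dim W)))
      \<le> ennreal (\<alpha> powr ?m) * (c * ennreal (\<alpha> powr (- ?m)))"
    by (rule mult_left_mono) simp
  also have "\<dots> = c * ennreal (\<alpha> powr ?m * \<alpha> powr (- ?m))"
    by (simp add: ennreal_mult mult_ac)
  also have "\<alpha> powr ?m * \<alpha> powr (- ?m) = 1"
    using \<alpha>(1) by (simp add: powr_add[symmetric])
  also have "ennreal (\<alpha> powr ?m) * ennreal (k powr (- (real (dim H) / 2)) * \<alpha> powr (- real (dim W)))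
     = ennreal (k powr (- (real (dim H) / 2)) * \<alpha> powr (?m - real (dim W)))"
    by (simp add: ennreal_mult[symmetric] powr_diff powr_minus field_simps)
  finally show ?thesis by (simp add: r_def)
qed

section \<open>Passage to the infimum, with the empty index set treated separately\<close>

theorem theorem1p2:
  fixes J :: "'j set"
    and H W :: "'a::euclidean_space set"
    and K :: "'j \<Rightarrow> 'b::euclidean_space set"
    and l :: "'j \<Rightarrow> 'a \<Rightarrow> 'b"
    and q :: "'j \<Rightarrow> real"
    and C \<alpha> :: real
  assumes "brascamp_lieb_datum J H K l q"
    and "C = 1 + (SUP j\<in>J. onorm_on H (l j))"
    and "0 < \<alpha>" and "\<alpha> \<le> 1"
    and "subspace W" and "W \<subseteq> H"
  shows "BL J H K l q \<ge>
           ennreal_powr (ennreal (C\<^sup>2 * (\<Sum>j\<in>J. q j))) (- (real (dim H) / 2)) *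
           ennreal (\<alpha> powr ((\<Sum>j\<in>J. q j * real (ess_rank \<alpha> (l j) W)) - real (dim W)))"
proof -
  interpret brascamp_lieb_datum J H K l q by (rule assms(1))
  let ?S = "\<Sum>j\<in>J. q j" and ?n = "real (dim H)"
  define A where "A = \<alpha> powr ((\<Sum>j\<in>J. q j * real (ess_rank \<alpha> (l j) W)) - real (dim W))"
  have A: "0 < A" using assms(3) by (simp add: A_def)
  note ge = is_BL_bound_ge[OF assms(1,5,6,3,4), folded A_def]
  have "ennreal_powr (ennreal (C\<^sup>2 * ?S)) (- (?n / 2)) * ennreal A \<le> c"
    if fin: "c < top" and c: "is_BL_bound J H K l q c" for c
  \<comment> \<open>For empty \<open>J\<close> the base \<open>C\<^sup>2 * ?S\<close> is 0 whatever
    \<open>C\<close> is, as the sum of the exponents vanishes. Its power is then 1 if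
    \<open>dim H = 0\<close> and infinite otherwise; in the latter case no finite \<open>c\<close>
    may be a bound.\<close>
  proof (cases "J = {}")
    case True
    \<comment> \<open>Without indices the norm bounds are vacuous, so 1 serves in place of
      \<open>C\<close> and every positive \<open>k\<close> is admissible.\<close>
    have ge': "ennreal (k powr (- (?n / 2)) * A) \<le> c" if "0 < k" for k
      using True that by (intro ge[of 1] c) auto
    show ?thesis
    proof (cases "dim H = 0")
      case dim: True
      with ge'[of 1] show ?thesis by (simp add: ennreal_powr_def)
    next
      case False
      obtain r where r: "c = ennreal r" "0 \<le> r" using fin by (cases c) auto
      \<comment> \<open>This \<open>k\<close> is chosen so that the lower bound equals
        \<open>r + 1\<close>, which contradicts \<open>c = ennreal r\<close>.\<close>
      define k where "k = ((r + 1) / A) powr (- (2 / ?n))"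
      have "k powr (- (?n / 2)) = (r + 1) / A"
        using False r A by (simp add: k_def powr_powr)
      moreover have "0 < k" using r A by (simp add: k_def)
      ultimately have "ennreal (r + 1) \<le> ennreal r" using ge'[of k] A r by simp
      then show ?thesis using r by simp
    qed
  next
    case False
    have on: "0 \<le> onorm_on H (l j)"
      and bound: "\<And>x. x \<in> H \<Longrightarrow> norm (l j x) \<le> onorm_on H (l j) * norm x" if "j \<in> J" for j
      using onorm_on_nonneg[OF linear_map[OF that] subspace_domain]
        onorm_on_bound[OF linear_map[OF that] subspace_domain] by auto
    have sup: "onorm_on H (l j) \<le> C - 1" if "j \<in> J" for j
      using finite_index that by (auto simp: assms(2) intro: cSUP_upper)
    \<comment> \<open>Some index exists, and its nonnegative operator norm is at most
      \<open>C - 1\<close>. Together with the positive sum of exponents this makes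
      \<open>k = C\<^sup>2 * ?S\<close> itself admissible.\<close>
    have C: "1 \<le> C" using False on sup by fastforce
    have S: "0 < ?S" using False finite_index exponent_pos by (intro sum_pos) auto
    have k: "0 < C\<^sup>2 * ?S" using C S by simp
    have "norm (l j x) \<le> (C - 1) * norm x" if "j \<in> J" "x \<in> H" for j x
      using bound[OF that] mult_right_mono[OF sup[OF that(1)], of "norm x"] by simp
    from ge[OF C this k order_refl c] k A show ?thesis
      by (simp add: ennreal_powr_ennreal ennreal_mult)
  qed
  then show ?thesis
    unfolding BL_def A_def by (intro Inf_greatest) auto
qed

end
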